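(* Let $\mathcal{B}_0,\ldots,\mathcal{B}_{L-1}$ be a set of $L$ mutually unbiased bases of $\mathbb{C}^d$. Then for every unit vector $|\psi\rangle\in\mathbb{C}^d$, $$\frac{1}{L}\sum_{j=0}^{L-1}H_{\infty}(\mathcal{B}_{j}\,|\,|\psi\rangle) \;\geq\; -\log\left[\frac{1}{d}\left(1 + \frac{d-1}{\sqrt{L}}\right)\right].$$
   Context: Two orthonormal bases $\{|a\rangle\}$ and $\{|b\rangle\}$ of $\mathbb{C}^d$ are mutually unbiased if $|\langle a|b\rangle| = 1/\sqrt{d}$ for all $|a\rangle$, $|b\rangle$; a set of bases is mutually unbiased if every two distinct members are. For an orthonormal basis $\mathcal{B}=\{|b\rangle\}_b$ and a unit vector $|\psi\rangle$, the min-entropy is $H_\infty(\mathcal{B}\,|\,|\psi\rangle) = -\log \max_{b} |\langle b|\psi\rangle|^2$. Logarithms are base 2. *)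

theory Defs
  imports "HOL-Analysis.Analysis"
begin

(* The library inner product on complex^'d is the real one, Re <x|y>. *)
definition cinner :: "complex ^ 'd \<Rightarrow> complex ^ 'd \<Rightarrow> complex" where
  "cinner x y = (\<Sum>i\<in>UNIV. cnj (x $ i) * y $ i)"

(* vec.span is the span over the complex scalars; the library constant span is over the reals. *)
definition orthonormal_basis :: "(complex ^ 'd) set \<Rightarrow> bool" where
  "orthonormal_basis B \<longleftrightarrow>
     (\<forall>b\<in>B. norm b = 1) \<and> pairwise (\<lambda>b c. cinner b c = 0) B \<and> vec.span B = UNIV"

definition unbiased :: "(complex ^ 'd) set \<Rightarrow> (complex ^ 'd) set \<Rightarrow> bool" where
  "unbiased A B \<longleftrightarrow> (\<forall>a\<in>A. \<forall>b\<in>B. cmod (cinner a b) = 1 / sqrt (real CARD('d)))"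

definition mutually_unbiased_bases :: "(complex ^ 'd) set set \<Rightarrow> bool" where
  "mutually_unbiased_bases S \<longleftrightarrow> (\<forall>B\<in>S. orthonormal_basis B) \<and> pairwise unbiased S"

definition min_entropy :: "(complex ^ 'd) set \<Rightarrow> complex ^ 'd \<Rightarrow> real" where
  "min_entropy B \<psi> = - log 2 (Max ((\<lambda>b. (cmod (cinner b \<psi>))\<^sup>2) ` B))"

end

theory Submission
  imports Defs
begin

text \<open>
  Let \<open>b\<^sub>j\<close> attain the maximum in the \<open>j\<close>-th basis, with value \<open>p\<^sub>j\<close>. For the Hilbert-Schmidt
  inner product, the traceless parts \<open>|b\<^sub>j\<rangle>\<langle>b\<^sub>j| - I/d\<close> are pairwise orthogonal by
  unbiasedness, and all traceless parts of rank-one projections have squared norm \<open>1 - 1/d\<close>.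
  Cauchy-Schwarz between \<open>|\<psi>\<rangle>\<langle>\<psi>| - I/d\<close> and the sum of these operators gives
  \<open>\<Sum>\<^sub>j (p\<^sub>j - 1/d) \<le> \<surd>L (1 - 1/d)\<close>, and concavity of the logarithm concludes.
\<close>

lemma inner_eq_Re_cinner: "x \<bullet> y = Re (cinner x y)"
  by (simp add: inner_vec_def cinner_def inner_complex_def)

lemma cinner_self: "cinner x x = complex_of_real ((norm x)\<^sup>2)"
proof -
  have "Im (cinner x x) = 0"
    by (simp add: cinner_def)
  moreover have "Re (cinner x x) = (norm x)\<^sup>2"
    by (simp add: inner_eq_Re_cinner[symmetric] power2_norm_eq_inner)
  ultimately show ?thesis
    by (simp add: complex_eq_iff)
qed

text \<open>\<open>cinner\<close> is conjugate-linear in its first argument, so the vectors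
  orthogonal to \<open>x\<close> are closed under complex combinations. With \<open>y = x\<close>
  this shows that no nonzero vector is orthogonal to a whole basis.\<close>

lemma cinner_eq_0_span:
  assumes "\<And>b. b \<in> B \<Longrightarrow> cinner b x = 0" and "y \<in> vec.span B"
  shows "cinner y x = 0"
  using assms(2)
proof (induction rule: vec.span_induct_alt)
  case base
  show ?case by (simp add: cinner_def)
next
  case (step c b y)
  have "cinner (c *s b + y) x = cnj c * cinner b x + cinner y x"
    by (simp add: cinner_def sum.distrib sum_distrib_left algebra_simps)
  then show ?case
    using step assms(1) by simp
qed

lemma orthonormal_basis_finite:
  assumes "orthonormal_basis B"
  shows "finite B"
proof (rule pairwise_orthogonal_imp_finite)
  \<comment> \<open>Complex orthogonality implies orthogonality for the real inner product, which is
    the real part of \<open>cinner\<close>.\<close>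
  show "pairwise orthogonal B"
    using assms
    by (auto simp: orthonormal_basis_def pairwise_def orthogonal_def inner_eq_Re_cinner)
qed

lemma orthonormal_basis_exists_cinner_nonzero:
  assumes "orthonormal_basis B" and "x \<noteq> 0"
  obtains b where "b \<in> B" and "cinner b x \<noteq> 0"
proof -
  have "cinner x x \<noteq> 0"
    using assms(2) by (simp add: cinner_self)
  then show ?thesis
    using cinner_eq_0_span[of B x x] assms(1) that
    by (auto simp: orthonormal_basis_def)
qed

text \<open>The nonzero overlap keeps the logarithm away from 0, where its value is only a
  convention; the concavity bound below needs positive arguments.\<close>

lemma min_entropy_attained:
  assumes "orthonormal_basis B" and "x \<noteq> 0"
  obtains b where "b \<in> B" and "cinner b x \<noteq> 0"
    and "min_entropy B x = - log 2 ((cmod (cinner b x))\<^sup>2)"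
proof -
  let ?f = "\<lambda>b. (cmod (cinner b x))\<^sup>2"
  have fin: "finite (?f ` B)"
    using orthonormal_basis_finite[OF assms(1)] by simp
  obtain c where c: "c \<in> B" "cinner c x \<noteq> 0"
    using orthonormal_basis_exists_cinner_nonzero[OF assms] .
  have "Max (?f ` B) \<in> ?f ` B"
    using fin c by (intro Max_in) auto
  then obtain b where b: "b \<in> B" "Max (?f ` B) = ?f b"
    by auto
  have "0 < ?f c" using c by simp
  also have "?f c \<le> ?f b"
    using Max_ge[OF fin, of "?f c"] c b by simp
  finally have "cinner b x \<noteq> 0" by auto
  with b show ?thesis
    using that by (simp add: min_entropy_def)
qed

text \<open>The operator |x><x|. On \<open>complex ^ 'd ^ 'd\<close> the library inner product is
  the real part of the Hilbert-Schmidt product, so library Cauchy-Schwarz applies to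
  operators.\<close>

definition outer :: "complex ^ 'd \<Rightarrow> complex ^ 'd ^ 'd" where
  "outer x = (\<chi> i k. x $ i * cnj (x $ k))"

lemma inner_outer_outer: "outer x \<bullet> outer y = (cmod (cinner x y))\<^sup>2"
proof -
  have "complex_of_real ((cmod (cinner x y))\<^sup>2) = cinner x y * cnj (cinner x y)"
    by (rule complex_norm_square)
  also have "\<dots> = (\<Sum>i\<in>UNIV. \<Sum>k\<in>UNIV. (cnj (x $ i) * y $ i) * (x $ k * cnj (y $ k)))"
    by (simp add: cinner_def sum_product)
  finally have "(cmod (cinner x y))\<^sup>2 =
      Re (\<Sum>i\<in>UNIV. \<Sum>k\<in>UNIV. (cnj (x $ i) * y $ i) * (x $ k * cnj (y $ k)))"
    by (metis Re_complex_of_real)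
  also have "\<dots> = outer x \<bullet> outer y"
    unfolding inner_vec_def outer_def Re_sum
    by (intro sum.cong refl) (simp add: inner_complex_def algebra_simps)
  finally show ?thesis by simp
qed

lemma inner_mat_right: "A \<bullet> (mat 1 :: complex ^ 'd ^ 'd) = Re (\<Sum>i\<in>UNIV. A $ i $ i)"
proof -
  have "A \<bullet> (mat 1 :: complex ^ 'd ^ 'd) =
      (\<Sum>i\<in>UNIV. \<Sum>k\<in>UNIV. if k = i then Re (A $ i $ i) else 0)"
    unfolding inner_vec_def mat_def
    by (intro sum.cong refl) (simp add: inner_complex_def)
  then show ?thesis by simp
qed

lemma inner_outer_mat: "outer x \<bullet> mat 1 = (norm x)\<^sup>2"
proof -
  have "outer x \<bullet> mat 1 = x \<bullet> x"
    unfolding inner_mat_right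
    by (simp add: outer_def inner_vec_def inner_complex_def)
  then show ?thesis by (simp add: power2_norm_eq_inner)
qed

definition traceless_outer :: "complex ^ 'd \<Rightarrow> complex ^ 'd ^ 'd" where
  "traceless_outer x = outer x - (1 / real CARD('d)) *\<^sub>R mat 1"

text \<open>Both cross terms with the identity contribute -1/d, and the identity paired with itself
  contributes d/d^2, leaving a net shift of -1/d.\<close>

lemma inner_traceless_outer:
  fixes x y :: "complex ^ 'd"
  assumes "norm x = 1" and "norm y = 1"
  shows "traceless_outer x \<bullet> traceless_outer y = (cmod (cinner x y))\<^sup>2 - 1 / real CARD('d)"
proof -
  have "mat 1 \<bullet> outer y = 1"
    using inner_outer_mat[of y] assms(2) by (simp add: inner_commute)
  moreover have "(mat 1 :: complex ^ 'd ^ 'd) \<bullet> mat 1 = real CARD('d)"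
    unfolding inner_mat_right by (simp add: mat_def)
  ultimately show ?thesis
    using assms(1)
    by (simp add: traceless_outer_def inner_diff_left inner_diff_right
        inner_outer_outer inner_outer_mat)
qed

lemma sum_overlap_unbiased_le:
  fixes b :: "'i \<Rightarrow> complex ^ 'd" and \<psi> :: "complex ^ 'd"
  assumes "finite I"
    and unit: "\<And>i. i \<in> I \<Longrightarrow> norm (b i) = 1" "norm \<psi> = 1"
    and unb: "\<And>i j. i \<in> I \<Longrightarrow> j \<in> I \<Longrightarrow> i \<noteq> j \<Longrightarrow>
                 cmod (cinner (b i) (b j)) = 1 / sqrt (real CARD('d))"
  shows "(\<Sum>i\<in>I. (cmod (cinner (b i) \<psi>))\<^sup>2)
           \<le> real (card I) / real CARD('d) + sqrt (real (card I)) * (1 - 1 / real CARD('d))"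
proof -
  define q where "q = 1 - 1 / real CARD('d)"
  define X where "X = (\<lambda>i. traceless_outer (b i))"
  have "q \<ge> 0" by (simp add: q_def)
  have self: "traceless_outer x \<bullet> traceless_outer x = q" if "norm x = 1" for x :: "complex ^ 'd"
    using that by (simp add: inner_traceless_outer cinner_self q_def)
  \<comment> \<open>Off the diagonal the squared overlap is exactly 1/d and cancels the shift; on
    the diagonal it is 1.\<close>
  have XX: "X i \<bullet> X j = (if j = i then q else 0)" if "i \<in> I" "j \<in> I" for i j
    using that unit unb[of i j] self[of "b i"]
    by (auto simp: X_def inner_traceless_outer power_divide)
  have "(\<Sum>i\<in>I. X i) \<bullet> (\<Sum>i\<in>I. X i) = (\<Sum>i\<in>I. \<Sum>j\<in>I. if i = j then q else 0)"
    by (simp add: inner_sum_left inner_sum_right XX cong: sum.cong)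
  also have "\<dots> = real (card I) * q"
    using \<open>finite I\<close> by simp
  finally have norm_sum: "norm (\<Sum>i\<in>I. X i) = sqrt (real (card I) * q)"
    by (simp add: norm_eq_sqrt_inner)
  have "(\<Sum>i\<in>I. (cmod (cinner (b i) \<psi>))\<^sup>2) - real (card I) / real CARD('d)
      = (\<Sum>i\<in>I. X i) \<bullet> traceless_outer \<psi>"
    using unit by (simp add: inner_sum_left X_def inner_traceless_outer sum_subtractf)
  also have "\<dots> \<le> norm (\<Sum>i\<in>I. X i) * norm (traceless_outer \<psi>)"
    by (rule norm_cauchy_schwarz)
  \<comment> \<open>The two norms are sqrt (|I| q) and sqrt q. Orthogonality is what yields sqrt |I|
    here in place of |I|.\<close>
  also have "\<dots> = sqrt (real (card I)) * q"
    using \<open>q \<ge> 0\<close> unit(2) unfolding norm_sum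
    by (simp add: norm_eq_sqrt_inner self real_sqrt_mult)
  finally show ?thesis by (simp add: q_def)
qed

text \<open>Jensen's inequality and monotonicity in one step: bound \<open>ln\<close> by its tangent
  at \<open>M\<close>. Summed over \<open>I\<close>, the linear terms are at most 0 by the bound on
  \<open>sum p I\<close>.\<close>

lemma sum_log_le_log_of_sum_le:
  fixes p :: "'i \<Rightarrow> real"
  assumes "\<And>i. i \<in> I \<Longrightarrow> p i > 0" and "M > 0" and "sum p I \<le> real (card I) * M"
  shows "(\<Sum>i\<in>I. log 2 (p i)) \<le> real (card I) * log 2 M"
proof -
  have "(\<Sum>i\<in>I. ln (p i)) \<le> (\<Sum>i\<in>I. ln M + (p i / M - 1))"
  proof (rule sum_mono)
    fix i assume "i \<in> I"
    then have "p i > 0" using assms(1) by simp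
    then show "ln (p i) \<le> ln M + (p i / M - 1)"
      using ln_le_minus_one[of "p i / M"] \<open>M > 0\<close> by (simp add: ln_div)
  qed
  also have "\<dots> = real (card I) * ln M + (sum p I / M - real (card I))"
    by (simp add: sum.distrib sum_subtractf sum_divide_distrib)
  also have "\<dots> \<le> real (card I) * ln M"
    using assms(2,3) by (simp add: divide_le_eq)
  finally show ?thesis
    by (simp add: log_def sum_divide_distrib[symmetric] divide_right_mono)
qed

theorem mainTheorem3:
  fixes \<B> :: "nat \<Rightarrow> (complex ^ 'd) set" and L :: nat and \<psi> :: "complex ^ 'd"
  assumes "L \<ge> 1"
    and "inj_on \<B> {..<L}"
    and "mutually_unbiased_bases (\<B> ` {..<L})"
    and "norm \<psi> = 1"
  shows "1 / real L * (\<Sum>j<L. min_entropy (\<B> j) \<psi>)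
           \<ge> - log 2 (1 / real CARD('d) * (1 + (real CARD('d) - 1) / sqrt (real L)))"
proof -
  define M where "M = 1 / real CARD('d) * (1 + (real CARD('d) - 1) / sqrt (real L))"
  have basis: "orthonormal_basis (\<B> j)" if "j < L" for j
    using assms(3) that by (auto simp: mutually_unbiased_bases_def)
  have "\<psi> \<noteq> 0" using assms(4) by auto
  then have "\<exists>b. b \<in> \<B> j \<and> cinner b \<psi> \<noteq> 0 \<and>
      min_entropy (\<B> j) \<psi> = - log 2 ((cmod (cinner b \<psi>))\<^sup>2)" if "j < L" for j
    using min_entropy_attained[OF basis[OF that]] by metis
  then obtain b where b: "\<And>j. j < L \<Longrightarrow> b j \<in> \<B> j" "\<And>j. j < L \<Longrightarrow> cinner (b j) \<psi> \<noteq> 0"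
    "\<And>j. j < L \<Longrightarrow> min_entropy (\<B> j) \<psi> = - log 2 ((cmod (cinner (b j) \<psi>))\<^sup>2)"
    by metis
  have unit: "norm (b j) = 1" if "j < L" for j
    using basis[OF that] b(1)[OF that] by (auto simp: orthonormal_basis_def)
  have unb: "cmod (cinner (b i) (b j)) = 1 / sqrt (real CARD('d))"
    if "i < L" "j < L" "i \<noteq> j" for i j
  proof -
    \<comment> \<open>Unbiasedness is stated for distinct members of a set of bases, so injectivity
      must turn distinct indices into distinct bases.\<close>
    have "\<B> i \<noteq> \<B> j" using assms(2) that by (auto dest: inj_onD)
    then have "unbiased (\<B> i) (\<B> j)"
      using assms(3) that by (auto simp: mutually_unbiased_bases_def pairwise_def)
    then show ?thesis using b(1) that by (auto simp: unbiased_def)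
  qed
  have "(1::real) \<le> real CARD('d)"
    using zero_less_card_finite[where 'a = 'd] by linarith
  then have "M > 0" by (simp add: M_def add_pos_nonneg)
  have "(\<Sum>j<L. (cmod (cinner (b j) \<psi>))\<^sup>2)
      \<le> real L / real CARD('d) + sqrt (real L) * (1 - 1 / real CARD('d))"
    using sum_overlap_unbiased_le[of "{..<L}" b \<psi>] unit unb assms(4) by simp
  \<comment> \<open>Uses L / sqrt L = sqrt L: \<open>M\<close> is the resulting bound on the average
    of the maximal overlaps.\<close>
  also have "\<dots> = real L * M"
    using assms(1) by (simp add: M_def field_simps)
  finally have "(\<Sum>j<L. log 2 ((cmod (cinner (b j) \<psi>))\<^sup>2)) \<le> real L * log 2 M"
    using sum_log_le_log_of_sum_le[of "{..<L}" "\<lambda>j. (cmod (cinner (b j) \<psi>))\<^sup>2" M] b(2) \<open>M > 0\<close>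
    by simp
  then have "1 / real L * (\<Sum>j<L. log 2 ((cmod (cinner (b j) \<psi>))\<^sup>2)) \<le> log 2 M"
    using assms(1) by (simp add: field_simps)
  moreover have "(\<Sum>j<L. min_entropy (\<B> j) \<psi>) = - (\<Sum>j<L. log 2 ((cmod (cinner (b j) \<psi>))\<^sup>2))"
    using b(3) by (simp add: sum_negf)
  ultimately show ?thesis
    unfolding M_def by simp
qed

end
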